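(* Let $N\ge1$ and let $\theta_N$ be a number such that $\|f\|_0+\|\hat f\|_0\ge N-\theta_N$ holds for all non-zero $f\in\mathbb{C}^N$. Let $g\in\mathbb{C}^N$ satisfy the following condition: for each $p\in\mathbb{Z}_N$, the sequence $c_p=(\langle g,g_{p,\ell}\rangle)_{\ell\in\mathbb{Z}_N}$ obeys $$\theta_N+2k+1\le\|c_p\|_0\le\hat k$$ for some positive integers $k$ and $\hat k$ (independent of $p$). Then, for any subsets $A\subseteq\mathbb{Z}_N$, $B\subseteq\mathbb{Z}_N$ with $$|A|\ge\theta_N+\hat k+1,\qquad|B|\ge\theta_N+(2k)^2-2k+2,$$ the set $\{g_\lambda:\lambda\in A\times B\}$ allows $k$-sparse phase retrieval.
   Context: Vectors in $\mathbb{C}^N$ are indexed by $\mathbb{Z}_N=\mathbb{Z}/N\mathbb{Z}$; $\omega=e^{2\pi i/N}$. $\|f\|_0$ is the number of non-zero entries of $f$, and $\hat f(j)=\sum_{n=0}^{N-1}f(n)\omega^{-nj}$ is the discrete Fourier transform. The scalar product is $\langle x,y\rangle=\sum_{j\in\mathbb{Z}_N}\overline{x(j)}\,y(j)$. Translations and modulations are $(T_px)(n)=x(n-p)$ and $(M_\ell x)(n)=\omega^{\ell n}x(n)$. For $\lambda=(p,\ell)\in\mathbb{Z}_N^2$ put $g_\lambda=g_{p,\ell}=M_\ell T_pg$ (so in $A\times B$, the set $A$ contains translation parameters and $B$ modulation parameters). Let $\mathbb{T}=\{c\in\mathbb{C}:|c|=1\}$ and $\mathcal{C}_k=\{x\in\mathbb{C}^N:\|x\|_0\le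 k\}$. A system $(g_\lambda)_{\lambda\in\Lambda}$ allows $k$-sparse phase retrieval if, whenever $x,y\in\mathcal{C}_k$ satisfy $|\langle x,g_\lambda\rangle|=|\langle y,g_\lambda\rangle|$ for all $\lambda\in\Lambda$, there is $c\in\mathbb{T}$ with $x=cy$. *)

theory Defs
  imports "HOL-Analysis.Analysis" "Berlekamp_Zassenhaus.Finite_Field"
begin

text \<open>
  The type \<open>'n mod_ring\<close> is the ring of integers modulo \<open>N = CARD('n)\<close>, for an arbitrary finite
  type \<open>'n\<close>; every \<open>N \<ge> 1\<close> arises in this way.  Accordingly
  \<open>complex ^ 'n mod_ring\<close> is the space of complex vectors indexed by Z/NZ.
\<close>

definition root_unity :: "nat \<Rightarrow> complex" where
  "root_unity N = exp (2 * of_real pi * \<i> / of_nat N)"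

text \<open>
  \<open>omega_pow j\<close> is \<open>\<omega>\<^sup>j\<close> for a residue class \<open>j\<close>, computed with the representative of \<open>j\<close> in
  \<open>{0..<N}\<close>; since \<open>\<omega>\<^sup>N = 1\<close>, the choice of representative is immaterial.
\<close>

definition omega_pow :: "'n::finite mod_ring \<Rightarrow> complex" where
  "omega_pow j = root_unity CARD('n) powi (to_int_mod_ring j)"

definition l0_norm :: "complex ^ 'i::finite \<Rightarrow> nat" where
  "l0_norm f = card {n. f $ n \<noteq> 0}"

definition dft :: "complex ^ 'n::finite mod_ring \<Rightarrow> complex ^ 'n mod_ring" where
  "dft f = (\<chi> j. \<Sum>n\<in>UNIV. f $ n * omega_pow (- (n * j)))"

text \<open>
  Conjugate-linear in the first argument.  The library's inner product on \<open>complex ^ 'i\<close> is real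
  valued and hence a different notion.
\<close>

definition scalar_prod :: "complex ^ 'i::finite \<Rightarrow> complex ^ 'i \<Rightarrow> complex" where
  "scalar_prod x y = (\<Sum>j\<in>UNIV. cnj (x $ j) * y $ j)"

definition translation ::
  "'n::finite mod_ring \<Rightarrow> complex ^ 'n mod_ring \<Rightarrow> complex ^ 'n mod_ring" where
  "translation p x = (\<chi> n. x $ (n - p))"

definition modulation ::
  "'n::finite mod_ring \<Rightarrow> complex ^ 'n mod_ring \<Rightarrow> complex ^ 'n mod_ring" where
  "modulation l x = (\<chi> n. omega_pow (l * n) * x $ n)"

definition gabor ::
  "complex ^ 'n::finite mod_ring \<Rightarrow> 'n mod_ring \<times> 'n mod_ring \<Rightarrow> complex ^ 'n mod_ring" where
  "gabor g = (\<lambda>(p, l). modulation l (translation p g))"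

definition sparse_vectors :: "nat \<Rightarrow> (complex ^ 'i::finite) set" where
  "sparse_vectors k = {x. l0_norm x \<le> k}"

definition allows_sparse_phase_retrieval ::
  "nat \<Rightarrow> 'l set \<Rightarrow> ('l \<Rightarrow> complex ^ 'i::finite) \<Rightarrow> bool" where
  "allows_sparse_phase_retrieval k \<Lambda> \<phi> \<longleftrightarrow>
     (\<forall>x \<in> sparse_vectors k. \<forall>y \<in> sparse_vectors k.
        (\<forall>l\<in>\<Lambda>. cmod (scalar_prod x (\<phi> l)) = cmod (scalar_prod y (\<phi> l))) \<longrightarrow>
        (\<exists>c. cmod c = 1 \<and> x = c *s y))"

end

theory Submission
  imports Defs
begin

text \<open>
  Phase retrieval for \<open>x\<close> and \<open>y\<close> amounts to the equality of the rank-one matrices \<open>x x\<^sup>*\<close> and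
  \<open>y y\<^sup>*\<close> (lemma \<open>equal_up_to_phase\<close>).  The matrix \<open>x x\<^sup>*\<close> is read here along its diagonals: the
  diagonal with offset \<open>d\<close> is the vector \<open>lag_product d x\<close>.  The phaseless measurements see the
  differences \<open>h\<^sub>d = lag_product d x - lag_product d y\<close> through two linear transformations, and the
  uncertainty inequality is used three times to undo them.

  For a fixed translation \<open>p\<close>, the squared measurement \<open>\<bar>\<langle>x, g\<^sub>p\<^sub>,\<^sub>l\<rangle>\<bar>\<^sup>2\<close> is a trigonometric
  polynomial in \<open>l\<close> whose coefficient at the frequency \<open>d\<close> is the correlation of \<open>lag_product d x\<close>
  with \<open>lag_product d g\<close>, evaluated at \<open>p\<close> (\<open>squared_measurement_expansion\<close>).  Only differences of
  support points occur as frequencies, at most \<open>(2k)\<^sup>2 - 2k + 1\<close> of them for \<open>x\<close> and \<open>y\<close> together.  As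
  the two polynomials agree on the large set \<open>B\<close>, the uncertainty inequality makes them equal, so
  for each \<open>d\<close> the correlation of \<open>h\<^sub>d\<close> with \<open>lag_product d g\<close> vanishes at every \<open>p \<in> A\<close>.

  The Fourier transform of this correlation is the product of the transform of \<open>h\<^sub>d\<close> and the
  sequence \<open>c\<^sub>-\<^sub>d\<close> (\<open>dft_correlation\<close>, \<open>scalar_prod_gabor_self\<close>).  This product has at most \<open>k_hat\<close> non-zero
  entries, and the correlation vanishes on the large set \<open>A\<close>; so the correlation is identically zero.
  Consequently the transform of \<open>h\<^sub>d\<close> vanishes wherever \<open>c\<^sub>-\<^sub>d\<close> does not, that is, at no fewer than
  \<open>\<theta> + 2k + 1\<close> points, while \<open>h\<^sub>d\<close> itself has at most \<open>2k\<close> non-zero entries: a last appeal to the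
  uncertainty inequality gives \<open>h\<^sub>d = 0\<close>.
\<close>

section \<open>The additive character of Z/NZ\<close>

lemma root_unity_powi: "root_unity N powi m = exp (2 * of_real pi * \<i> * of_int m / of_nat N)"
  by (simp add: root_unity_def exp_power_int mult_ac)

lemma root_unity_powi_eq_1_iff:
  assumes "N > 0"
  shows "root_unity N powi m = 1 \<longleftrightarrow> int N dvd m"
proof -
  have "root_unity N powi m = 1 \<longleftrightarrow> (\<exists>n::int. 2 * pi * of_int m / of_nat N = of_int (2 * n) * pi)"
    by (simp add: root_unity_powi exp_eq_1)
  also have "\<dots> \<longleftrightarrow> (\<exists>n::int. real_of_int m = real_of_int (int N * n))"
    using assms by (simp add: field_simps)
  also have "\<dots> \<longleftrightarrow> int N dvd m"
    unfolding of_int_eq_iff dvd_def ..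
  finally show ?thesis .
qed

lemma root_unity_powi_mod:
  assumes "N > 0"
  shows "root_unity N powi (m mod int N) = root_unity N powi m"
proof -
  have nz: "root_unity N \<noteq> 0"
    by (simp add: root_unity_def)
  have "root_unity N powi m = root_unity N powi (int N * (m div int N) + m mod int N)"
    by simp
  also have "\<dots> = root_unity N powi (int N * (m div int N)) * root_unity N powi (m mod int N)"
    by (rule power_int_add) (simp add: nz)
  also have "root_unity N powi (int N * (m div int N)) = 1"
    using assms root_unity_powi_eq_1_iff by simp
  finally show ?thesis
    by simp
qed

lemma omega_pow_0 [simp]: "omega_pow 0 = 1"
  by (simp add: omega_pow_def)

lemma omega_pow_add: "omega_pow (a + b) = omega_pow a * omega_pow b"
proof -
  have "to_int_mod_ring (a + b) = (to_int_mod_ring a + to_int_mod_ring b) mod int CARD('a)"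
    by transfer simp
  moreover have "root_unity CARD('a) \<noteq> 0"
    by (simp add: root_unity_def)
  ultimately show ?thesis
    by (simp add: omega_pow_def root_unity_powi_mod power_int_add)
qed

lemma norm_omega_pow [simp]: "cmod (omega_pow a) = 1"
  by (simp add: omega_pow_def root_unity_powi)

lemma cnj_omega_pow: "cnj (omega_pow a) = omega_pow (- a)"
proof -
  have "omega_pow a * omega_pow (- a) = 1"
    by (simp flip: omega_pow_add)
  moreover have "omega_pow a * cnj (omega_pow a) = 1"
    by (simp add: complex_norm_square [symmetric])
  moreover have "omega_pow a \<noteq> 0"
    using norm_omega_pow [of a] by force
  ultimately show ?thesis
    by (metis mult_left_cancel)
qed

lemma exists_omega_pow_neq_1:
  fixes j :: "'n::finite mod_ring"
  assumes "j \<noteq> 0"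
  shows "\<exists>n. omega_pow (n * j) \<noteq> 1"
proof -
  let ?t = "to_int_mod_ring j"
  have t: "0 < ?t" "?t < int CARD('n)"
    using assms range_to_int_mod_ring [where 'a = 'n] rangeI [of to_int_mod_ring j]
    by (auto simp: order_le_less)
  \<comment> \<open>The residue class of 1, named by its representative: the constant 1 exists on the type only
    when its sort guarantees \<open>N > 1\<close>.\<close>
  let ?e = "of_int_mod_ring 1 :: 'n mod_ring"
  have "to_int_mod_ring (?e * j) = to_int_mod_ring ?e * ?t mod int CARD('n)"
    by transfer simp
  also have "\<dots> = ?t"
    using t by simp
  finally have "omega_pow (?e * j) = root_unity CARD('n) powi ?t"
    by (simp add: omega_pow_def)
  moreover have "\<not> int CARD('n) dvd ?t"
    using t zdvd_not_zless by blast
  ultimately show ?thesis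
    using root_unity_powi_eq_1_iff [of "CARD('n)" ?t] by (metis zero_less_card_finite)
qed

lemma sum_translate:
  fixes a :: "'a::{finite, ab_group_add}"
  shows "(\<Sum>n\<in>UNIV. f (n + a)) = (\<Sum>n\<in>UNIV. f n)"
  by (rule sum.reindex_bij_witness [where i = "\<lambda>n. n - a" and j = "\<lambda>n. n + a"]) auto

text \<open>
  Translating the summation variable by \<open>m\<close> multiplies the sum by \<open>\<omega>\<^sup>m\<^sup>j\<close>, and for \<open>j \<noteq> 0\<close> some
  \<open>m\<close> makes this factor different from 1.
\<close>

lemma sum_omega_pow:
  fixes j :: "'n::finite mod_ring"
  shows "(\<Sum>n\<in>UNIV. omega_pow (n * j)) = (if j = 0 then of_nat CARD('n) else 0)"
proof (cases "j = 0")
  case False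
  then obtain m where m: "omega_pow (m * j) \<noteq> 1"
    using exists_omega_pow_neq_1 by blast
  have "(\<Sum>n\<in>UNIV. omega_pow (n * j)) = (\<Sum>n\<in>UNIV. omega_pow ((n + m) * j))"
    by (rule sum_translate [symmetric])
  also have "\<dots> = (\<Sum>n\<in>UNIV. omega_pow (n * j)) * omega_pow (m * j)"
    by (simp add: ring_distribs omega_pow_add sum_distrib_right)
  finally show ?thesis
    using m False by simp
qed simp

section \<open>Fourier transforms of polynomials and correlations\<close>

lemma dft_zero: "dft 0 = 0"
  by (simp add: dft_def vec_eq_iff)

lemma dft_trigonometric_polynomial:
  fixes a :: "'n::finite mod_ring \<Rightarrow> complex"
  shows "dft (\<chi> l. \<Sum>d\<in>UNIV. a d * omega_pow (l * d)) $ e = of_nat CARD('n) * a e"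
proof -
  have "dft (\<chi> l. \<Sum>d\<in>UNIV. a d * omega_pow (l * d)) $ e
      = (\<Sum>l\<in>UNIV. \<Sum>d\<in>UNIV. a d * omega_pow (l * (d - e)))"
    by (simp add: dft_def sum_distrib_right mult.assoc right_diff_distrib flip: omega_pow_add)
  also have "\<dots> = (\<Sum>d\<in>UNIV. a d * (\<Sum>l\<in>UNIV. omega_pow (l * (d - e))))"
    by (subst sum.swap) (simp add: sum_distrib_left)
  also have "\<dots> = of_nat CARD('n) * a e"
    by (simp add: sum_omega_pow if_distrib sum.delta mult.commute cong: if_cong)
  finally show ?thesis .
qed

lemma dft_correlation:
  fixes h \<gamma> :: "'n::finite mod_ring \<Rightarrow> complex"
  shows "dft (\<chi> p. \<Sum>j\<in>UNIV. h j * \<gamma> (j - p)) $ e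
       = dft (\<chi> j. h j) $ e * (\<Sum>m\<in>UNIV. \<gamma> m * omega_pow (e * m))"
proof -
  have inner: "(\<Sum>p\<in>UNIV. \<gamma> (j - p) * omega_pow (- (p * e)))
      = omega_pow (- (j * e)) * (\<Sum>m\<in>UNIV. \<gamma> m * omega_pow (e * m))" for j
  proof -
    have "(\<Sum>p\<in>UNIV. \<gamma> (j - p) * omega_pow (- (p * e)))
        = (\<Sum>m\<in>UNIV. \<gamma> m * omega_pow (- (j * e) + e * m))"
      by (rule sum.reindex_bij_witness [where i = "\<lambda>m. j - m" and j = "\<lambda>p. j - p"])
        (auto simp: algebra_simps)
    also have "\<dots> = omega_pow (- (j * e)) * (\<Sum>m\<in>UNIV. \<gamma> m * omega_pow (e * m))"
      unfolding omega_pow_add sum_distrib_left by (simp only: mult_ac)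
    finally show ?thesis .
  qed
  have "dft (\<chi> p. \<Sum>j\<in>UNIV. h j * \<gamma> (j - p)) $ e
      = (\<Sum>p\<in>UNIV. \<Sum>j\<in>UNIV. h j * (\<gamma> (j - p) * omega_pow (- (p * e))))"
    by (simp add: dft_def sum_distrib_right mult.assoc)
  also have "\<dots> = (\<Sum>j\<in>UNIV. h j * (\<Sum>p\<in>UNIV. \<gamma> (j - p) * omega_pow (- (p * e))))"
    by (subst sum.swap) (simp add: sum_distrib_left)
  finally show ?thesis
    by (simp add: inner dft_def sum_distrib_right mult.assoc)
qed

section \<open>Measurements in terms of diagonals\<close>

text \<open>The entries of the matrix \<open>x x\<^sup>*\<close> on the diagonal with offset \<open>d\<close>.\<close>

definition lag_product :: "'n::finite mod_ring \<Rightarrow> complex ^ 'n mod_ring \<Rightarrow> 'n mod_ring \<Rightarrow> complex"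
  where "lag_product d x j = cnj (x $ (j + d)) * x $ j"

lemma gabor_nth: "gabor g (p, l) $ n = omega_pow (l * n) * g $ (n - p)"
  by (simp add: gabor_def modulation_def translation_def)

text \<open>
  Expanding the square into a double sum over \<open>i\<close> and \<open>j\<close>, the characters combine to
  \<open>\<omega>\<^bsup>l(i - j)\<^esup>\<close>; so the terms are grouped by the difference \<open>d = i - j\<close>.
\<close>

lemma squared_measurement_expansion:
  fixes x g :: "complex ^ 'n::finite mod_ring"
  shows "complex_of_real ((cmod (scalar_prod x (gabor g (p, l))))\<^sup>2)
       = (\<Sum>d\<in>UNIV. (\<Sum>j\<in>UNIV. lag_product d x j * cnj (lag_product d g (j - p))) * omega_pow (l * d))"
proof -
  define t where "t i = cnj (x $ i) * (omega_pow (l * i) * g $ (i - p))" for i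
  have s: "scalar_prod x (gabor g (p, l)) = (\<Sum>i\<in>UNIV. t i)"
    by (simp add: scalar_prod_def gabor_nth t_def)
  have shifted: "t (j + d) * cnj (t j)
      = lag_product d x j * cnj (lag_product d g (j - p)) * omega_pow (l * d)" for j d
  proof -
    have "l * d = l * (j + d) + - (l * j)"
      by (simp add: algebra_simps)
    then have "omega_pow (l * d) = omega_pow (l * (j + d)) * omega_pow (- (l * j))"
      by (metis omega_pow_add)
    then show ?thesis
      by (simp add: t_def lag_product_def cnj_omega_pow algebra_simps)
  qed
  have "complex_of_real ((cmod (\<Sum>i\<in>UNIV. t i))\<^sup>2) = (\<Sum>j\<in>UNIV. \<Sum>i\<in>UNIV. t i * cnj (t j))"
    unfolding complex_norm_square
    by (simp add: sum_distrib_left sum_distrib_right)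
  also have "\<dots> = (\<Sum>j\<in>UNIV. \<Sum>d\<in>UNIV. t (d + j) * cnj (t j))"
    by (intro sum.cong refl sum_translate [symmetric])
  also have "\<dots> = (\<Sum>d\<in>UNIV. \<Sum>j\<in>UNIV. t (j + d) * cnj (t j))"
    by (subst sum.swap) (simp add: add.commute)
  finally show ?thesis
    by (simp add: s shifted sum_distrib_right)
qed

lemma scalar_prod_gabor_self:
  "scalar_prod g (gabor g (- d, l)) = (\<Sum>m\<in>UNIV. cnj (lag_product d g m) * omega_pow (l * m))"
  by (simp add: scalar_prod_def gabor_nth lag_product_def mult_ac)

text \<open>
  At a fixed index \<open>i\<close> with \<open>x\<^sub>i \<noteq> 0\<close>, the \<open>i\<close>-th column of \<open>x x\<^sup>* = y y\<^sup>*\<close> displays \<open>x\<close> as a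
  multiple of \<open>y\<close>; the diagonal entry shows that the factor has modulus one.
\<close>

lemma equal_up_to_phase:
  fixes x y :: "complex ^ 'n::finite mod_ring"
  assumes "\<And>d j. lag_product d x j = lag_product d y j"
  shows "\<exists>c. cmod c = 1 \<and> x = c *s y"
proof -
  have prods: "cnj (x $ i) * x $ j = cnj (y $ i) * y $ j" for i j
    using assms [of "i - j" j] by (simp add: lag_product_def)
  have "complex_of_real ((cmod (x $ j))\<^sup>2) = complex_of_real ((cmod (y $ j))\<^sup>2)" for j
    using prods [of j j] by (simp only: complex_norm_square mult.commute)
  then have norms: "cmod (x $ j) = cmod (y $ j)" for j
    unfolding of_real_eq_iff by (simp add: power2_eq_iff_nonneg)
  show ?thesis
  proof (cases "x = 0")
    case True
    then have "y $ j = 0" for j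
      using norms [of j] by simp
    then have "x = 1 *s y"
      using True by (simp add: vec_eq_iff)
    then show ?thesis
      using norm_one by blast
  next
    case False
    then obtain i where i: "x $ i \<noteq> 0"
      by (auto simp: vec_eq_iff)
    let ?c = "cnj (y $ i) / cnj (x $ i)"
    have "x = ?c *s y"
      using i prods [of i] by (simp add: vec_eq_iff field_simps)
    moreover have "cmod ?c = 1"
      using i norms [of i] by (auto simp: norm_divide)
    ultimately show ?thesis
      by blast
  qed
qed

section \<open>Counting support points\<close>

lemma l0_norm_le_card: "(\<And>n. f $ n \<noteq> 0 \<Longrightarrow> n \<in> S) \<Longrightarrow> l0_norm f \<le> card S"
  unfolding l0_norm_def by (intro card_mono) auto

lemma l0_norm_add_card_zeros_le:
  fixes f :: "complex ^ 'i::finite"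
  assumes "\<And>n. n \<in> S \<Longrightarrow> f $ n = 0"
  shows "l0_norm f + card S \<le> CARD('i)"
proof -
  have "l0_norm f + card S = card ({n. f $ n \<noteq> 0} \<union> S)"
    unfolding l0_norm_def using assms by (subst card_Un_disjoint) auto
  also have "\<dots> \<le> CARD('i)"
    by (simp add: card_mono)
  finally show ?thesis .
qed

text \<open>All pairs on the diagonal of \<open>S \<times> S\<close> have the same difference 0.\<close>

lemma card_differences_le:
  fixes S :: "'a::ab_group_add set"
  assumes "finite S"
  shows "card {i - j |i j. i \<in> S \<and> j \<in> S} \<le> card S * (card S - 1) + 1"
proof -
  let ?D = "(\<lambda>i. (i, i)) ` S"
  let ?P = "S \<times> S - ?D"
  have "card ?D = card S"
    by (intro card_image inj_onI) simp
  then have P: "card ?P = card S * (card S - 1)"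
    using assms by (subst card_Diff_subset) (auto simp: card_cartesian_product diff_mult_distrib2)
  have "{i - j |i j. i \<in> S \<and> j \<in> S} \<subseteq> insert 0 ((\<lambda>(i, j). i - j) ` ?P)"
    by force
  then have "card {i - j |i j. i \<in> S \<and> j \<in> S} \<le> card (insert 0 ((\<lambda>(i, j). i - j) ` ?P))"
    using assms by (intro card_mono) auto
  also have "\<dots> \<le> card ((\<lambda>(i, j). i - j) ` ?P) + 1"
    by (simp add: card_insert_le_m1)
  also have "\<dots> \<le> card ?P + 1"
    using assms by (simp add: card_image_le)
  finally show ?thesis
    by (simp add: P)
qed

section \<open>Phase retrieval\<close>

theorem theorem3p3:
  fixes \<theta> :: real
    and g :: "complex ^ 'n::finite mod_ring"
    and k k_hat :: nat
    and A B :: "'n mod_ring set"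
  assumes theta: "\<forall>f :: complex ^ 'n mod_ring. f \<noteq> 0 \<longrightarrow>
             real (l0_norm f) + real (l0_norm (dft f)) \<ge> real CARD('n) - \<theta>"
    and "k > 0" and "k_hat > 0"
    and window: "\<forall>p :: 'n mod_ring.
             \<theta> + 2 * real k + 1 \<le> real (l0_norm (\<chi> l. scalar_prod g (gabor g (p, l)))) \<and>
             l0_norm (\<chi> l. scalar_prod g (gabor g (p, l))) \<le> k_hat"
    and "real (card A) \<ge> \<theta> + real k_hat + 1"
    and "real (card B) \<ge> \<theta> + (2 * real k)\<^sup>2 - 2 * real k + 2"
  shows "allows_sparse_phase_retrieval k (A \<times> B) (gabor g)"
  unfolding allows_sparse_phase_retrieval_def
proof (intro ballI impI)
  fix x y :: "complex ^ 'n mod_ring"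
  assume x: "x \<in> sparse_vectors k" and y: "y \<in> sparse_vectors k"
    and eq: "\<forall>l\<in>A \<times> B. cmod (scalar_prod x (gabor g l)) = cmod (scalar_prod y (gabor g l))"
  have zero: "f = 0" if "real (l0_norm f) + real (l0_norm (dft f)) < real CARD('n) - \<theta>"
    for f :: "complex ^ 'n mod_ring"
    using theta that by force

  define S where "S = {j. x $ j \<noteq> 0 \<or> y $ j \<noteq> 0}"
  have "S = {j. x $ j \<noteq> 0} \<union> {j. y $ j \<noteq> 0}"
    by (auto simp: S_def)
  then have card_S: "card S \<le> 2 * k"
    using x y card_Un_le [of "{j. x $ j \<noteq> 0}" "{j. y $ j \<noteq> 0}"]
    by (simp add: sparse_vectors_def l0_norm_def)
  define h where "h d j = lag_product d x j - lag_product d y j" for d j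
  have h_support: "j + d \<in> S \<and> j \<in> S" if "h d j \<noteq> 0" for d j
    using that by (auto simp: h_def lag_product_def S_def)

  let ?corr = "\<lambda>d p. \<Sum>j\<in>UNIV. h d j * cnj (lag_product d g (j - p))"

  have corr_on_A: "?corr d p = 0" if p: "p \<in> A" for d p
  proof -
    let ?F = "\<chi> l. \<Sum>d\<in>UNIV. ?corr d p * omega_pow (l * d)"
    let ?D = "{i - j |i j. i \<in> S \<and> j \<in> S}"
    have F: "?F $ l = complex_of_real ((cmod (scalar_prod x (gabor g (p, l))))\<^sup>2)
        - complex_of_real ((cmod (scalar_prod y (gabor g (p, l))))\<^sup>2)" for l
      unfolding squared_measurement_expansion
      by (simp add: h_def left_diff_distrib sum_subtractf)
    have "?F $ l = 0" if "l \<in> B" for l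
      using eq p that unfolding F by simp
    then have space: "l0_norm ?F + card B \<le> CARD('n)"
      using l0_norm_add_card_zeros_le [of B ?F] by simp
    have "d \<in> ?D" if "dft ?F $ d \<noteq> 0" for d
    proof -
      have "?corr d p \<noteq> 0"
        using that unfolding dft_trigonometric_polynomial by simp
      then obtain j where "h d j \<noteq> 0"
        by (metis (no_types, lifting) mult_zero_left sum.neutral)
      then have "d = (j + d) - j" "j + d \<in> S" "j \<in> S"
        using h_support by auto
      then show ?thesis
        by blast
    qed
    then have "l0_norm (dft ?F) \<le> card ?D"
      by (rule l0_norm_le_card)
    also have "\<dots> \<le> card S * (card S - 1) + 1"
      by (rule card_differences_le) simp
    also have "\<dots> \<le> 2 * k * (2 * k - 1) + 1"
      using card_S by (intro add_mono mult_mono) auto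
    finally have "real (l0_norm (dft ?F)) \<le> real (2 * k * (2 * k - 1) + 1)"
      by (simp only: of_nat_le_iff)
    also have "\<dots> = (2 * real k)\<^sup>2 - 2 * real k + 1"
      by (cases k) (simp_all add: power2_eq_square algebra_simps)
    finally have freq: "real (l0_norm (dft ?F)) \<le> (2 * real k)\<^sup>2 - 2 * real k + 1" .
    have "?F = 0"
    proof (rule zero)
      have "real (l0_norm ?F) + real (card B) \<le> real CARD('n)"
        using space by linarith
      then show "real (l0_norm ?F) + real (l0_norm (dft ?F)) < real CARD('n) - \<theta>"
        using freq assms(6) by linarith
    qed
    then have "dft ?F $ d = 0"
      by (simp only: dft_zero zero_index)
    then show ?thesis
      unfolding dft_trigonometric_polynomial by simp
  qed

  have "h d j = 0" for d j
  proof -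
    let ?c = "\<chi> l. scalar_prod g (gabor g (- d, l))"
    let ?G = "\<chi> p. ?corr d p"
    let ?h = "\<chi> j. h d j"
    have dft_G: "dft ?G $ e = dft ?h $ e * ?c $ e" for e
      by (simp add: dft_correlation [where \<gamma> = "\<lambda>j. cnj (lag_product d g j)"] scalar_prod_gabor_self)
    have "?G = 0"
    proof (rule zero)
      have "l0_norm ?G + card A \<le> CARD('n)"
        using l0_norm_add_card_zeros_le [of A ?G] corr_on_A by simp
      moreover have "l0_norm (dft ?G) \<le> l0_norm ?c"
        unfolding l0_norm_def [of ?c] by (rule l0_norm_le_card) (auto simp: dft_G)
      ultimately show "real (l0_norm ?G) + real (l0_norm (dft ?G)) < real CARD('n) - \<theta>"
        using window [rule_format, of "- d"] assms(5) by linarith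
    qed
    then have "dft ?G $ e = 0" for e
      by (simp only: dft_zero zero_index)
    then have h_c: "dft ?h $ e = 0" if "?c $ e \<noteq> 0" for e
    proof -
      have "dft ?h $ e * ?c $ e = 0"
        using \<open>dft ?G $ e = 0\<close> by (simp only: dft_G)
      then show ?thesis
        using that by (simp only: mult_eq_0_iff) blast
    qed
    have "?h = 0"
    proof (rule zero)
      have "l0_norm ?h \<le> card S"
        by (rule l0_norm_le_card) (use h_support in auto)
      moreover have "l0_norm (dft ?h) + l0_norm ?c \<le> CARD('n)"
        unfolding l0_norm_def [of ?c]
        using l0_norm_add_card_zeros_le [of "{e. ?c $ e \<noteq> 0}" "dft ?h"] h_c by simp
      ultimately show "real (l0_norm ?h) + real (l0_norm (dft ?h)) < real CARD('n) - \<theta>"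
        using card_S window [rule_format, of "- d"] by linarith
    qed
    then show ?thesis
      by (simp add: vec_eq_iff)
  qed
  then show "\<exists>c. cmod c = 1 \<and> x = c *s y"
    by (intro equal_up_to_phase) (simp add: h_def)
qed

end
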